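(* Let $\mathcal N$ be an $n$-level $\Pi^3$-net and let $m_0$ be a live marking of $\mathcal N$. Then $\mathcal R(m_0)$ equals the set $\mathcal S(m_0)$ of markings $m\in\mathbb N^P$ that satisfy the $n$-condition ($m(P_n)>0$ and $m(P_{j-1})\ge\varphi_j(m)$ for all $2\le j\le n$) and satisfy $\widetilde m(P_i)=\widetilde{m_0}(P_i)$ for all $1\le i\le n$.
   Context: A Petri net is $(P,T,W^-,W^+)$ with $W^-,W^+\in\mathbb N^{P\times T}$; ${}^\bullet t,t^\bullet$ the columns of $W^-,W^+$. Markings $m\in\mathbb N^P$, enabling ($m\ge{}^\bullet t$), firing ($m\mapsto m-{}^\bullet t+t^\bullet$), reachability set $\mathcal R(m_0)$ as usual; $m_0$ is live if from every marking of $\mathcal R(m_0)$ every transition can be enabled again; $x(P')=\sum_{p\in P'}x(p)$. Weakly reversible: every connected component of the reaction graph (nodes $\{{}^\bullet t\}\cup\{t^\bullet\}$, arcs $({}^\bullet t,t^\bullet)$) is strongly connected. For $n\ge2$, an $n$-level ordered $\Pi$-net is a weakly reversible net with partitions $P=P_1\sqcup\dots\sqcup P_n$, $T=T_1\sqcup\dots\sqcup T_n$ such that: (1) each $P_i\ne\emptyset$; (2) $(P_i,T_i,W^-|_{P_i\times T_i},W^+|_{P_i\times T_i})$ is a strongly connected state machine (each transition of $T_i$ has exactly one input and one output place in $P_i$, with weight $1$); (3) for $t\in T_i$, ${}^\bullet t(p)>0$ implies $p\in P_i\cup P_{i-1}$ ($P_0=\emptyset$); (4) for $2\le i\le n$ some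 $t\in T_i$, $p\in P_{i-1}$ have ${}^\bullet t(p)>0$; (5) for $t,t'\in T_i$, if ${}^\bullet t$ and ${}^\bullet t'$ share a place of $P_i$ then ${}^\bullet t={}^\bullet t'$. Potentials: for $p\in P_i$ ($i\ge2$), $q\in P_{i-1}$, $pot(p,q)=t^\bullet(q)$ if some $t\in T_i$ has $t^\bullet(p)>0$ and $t^\bullet(q)>0$ (independent of $t$), else $0$; $pot(p)=\sum_{q\in P_{i-1}}pot(p,q)$ for $p\in P_i$, $i\ge2$; $pot(p)=0$ for $p\in P_1$. A $\Pi^3$-net is an ordered $\Pi$-net such that for every $1\le i\le n-1$ and $p\in P_i$ with ${}^\bullet t(p)>0$ for some $t\in T_{i+1}$, $pot(p)=\max\{pot(q):q\in P_i\}$. For $2\le i\le n$: $\varphi_i(m)=\max\{pot(p):p\in P_i\}$ if $m(P_i)=0$, else $\varphi_i(m)=\min\{pot(p):p\in P_i, m(p)>0\}$. The marking witness of $m\in\mathbb Z^P$ is given for $p\in P_i$ by $\widetilde m(p)=m(p)+\sum_{j=1}^{n-i}(-1)^j\sum_{r_1\in P_{i+1},\dots,r_j\in P_{i+j}}m(r_j)\big(\prod_{k=1}^{j-1}pot(r_{k+1},r_k)\big)pot(r_1,p)$. *)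

theory Defs
  imports Main "HOL-Library.FuncSet" "HOL-Library.Disjoint_Sets"
begin

section \<open>Petri nets\<close>

text \<open>
  Vectors over the place set are total functions on the type of places that vanish outside the
  place set. The weight functions are only ever read on places x transitions.
\<close>

record ('p, 't) petri_net =
  places :: "'p set"
  transitions :: "'t set"
  Wminus :: "'p \<Rightarrow> 't \<Rightarrow> nat"
  Wplus :: "'p \<Rightarrow> 't \<Rightarrow> nat"

definition petri_net :: "('p, 't) petri_net \<Rightarrow> bool" where
  "petri_net N \<longleftrightarrow> finite (places N) \<and> finite (transitions N)"

definition inp :: "('p, 't) petri_net \<Rightarrow> 't \<Rightarrow> 'p \<Rightarrow> nat" where
  "inp N t = (\<lambda>p. if p \<in> places N then Wminus N p t else 0)"

definition out :: "('p, 't) petri_net \<Rightarrow> 't \<Rightarrow> 'p \<Rightarrow> nat" where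
  "out N t = (\<lambda>p. if p \<in> places N then Wplus N p t else 0)"

definition markings :: "('p, 't) petri_net \<Rightarrow> ('p \<Rightarrow> nat) set" where
  "markings N = {m. \<forall>p. p \<notin> places N \<longrightarrow> m p = 0}"

definition enabled :: "('p, 't) petri_net \<Rightarrow> ('p \<Rightarrow> nat) \<Rightarrow> 't \<Rightarrow> bool" where
  "enabled N m t \<longleftrightarrow> (\<forall>p. inp N t p \<le> m p)"

definition fires :: "('p, 't) petri_net \<Rightarrow> ('p \<Rightarrow> nat) \<Rightarrow> ('p \<Rightarrow> nat) \<Rightarrow> bool" where
  "fires N m m' \<longleftrightarrow>
     (\<exists>t\<in>transitions N. enabled N m t \<and> m' = (\<lambda>p. m p - inp N t p + out N t p))"

definition reachability_set :: "('p, 't) petri_net \<Rightarrow> ('p \<Rightarrow> nat) \<Rightarrow> ('p \<Rightarrow> nat) set" where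
  "reachability_set N m0 = {m. (fires N)\<^sup>*\<^sup>* m0 m}"

definition live :: "('p, 't) petri_net \<Rightarrow> ('p \<Rightarrow> nat) \<Rightarrow> bool" where
  "live N m0 \<longleftrightarrow>
     (\<forall>m\<in>reachability_set N m0. \<forall>t\<in>transitions N. \<exists>m'\<in>reachability_set N m. enabled N m' t)"


section \<open>Weak reversibility and state machines\<close>

definition connected_components :: "'a set \<Rightarrow> ('a \<times> 'a) set \<Rightarrow> 'a set set" where
  "connected_components V E = V // (((E \<union> E\<inverse>)\<^sup>*) \<inter> V \<times> V)"

definition strongly_connected :: "'a set \<Rightarrow> ('a \<times> 'a) set \<Rightarrow> bool" where
  "strongly_connected V E \<longleftrightarrow> (\<forall>x\<in>V. \<forall>y\<in>V. (x, y) \<in> (E \<inter> V \<times> V)\<^sup>*)"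

definition reaction_nodes :: "('p, 't) petri_net \<Rightarrow> ('p \<Rightarrow> nat) set" where
  "reaction_nodes N = inp N ` transitions N \<union> out N ` transitions N"

definition reaction_arcs :: "('p, 't) petri_net \<Rightarrow> (('p \<Rightarrow> nat) \<times> ('p \<Rightarrow> nat)) set" where
  "reaction_arcs N = (\<lambda>t. (inp N t, out N t)) ` transitions N"

definition weakly_reversible :: "('p, 't) petri_net \<Rightarrow> bool" where
  "weakly_reversible N \<longleftrightarrow>
     (\<forall>C\<in>connected_components (reaction_nodes N) (reaction_arcs N).
        strongly_connected C (reaction_arcs N))"

definition restrict_net :: "('p, 't) petri_net \<Rightarrow> 'p set \<Rightarrow> 't set \<Rightarrow> ('p, 't) petri_net" where
  "restrict_net N P' T' = N\<lparr>places := P', transitions := T'\<rparr>"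

definition state_machine :: "('p, 't) petri_net \<Rightarrow> bool" where
  "state_machine N \<longleftrightarrow>
     (\<forall>t\<in>transitions N.
        (\<exists>p\<in>places N. inp N t = (\<lambda>q. if q = p then 1 else 0)) \<and>
        (\<exists>p\<in>places N. out N t = (\<lambda>q. if q = p then 1 else 0)))"

text \<open>The bipartite graph of the net: \<open>Inl\<close> marks places, \<open>Inr\<close> marks transitions.\<close>

definition net_arcs :: "('p, 't) petri_net \<Rightarrow> (('p + 't) \<times> ('p + 't)) set" where
  "net_arcs N =
     {(Inl p, Inr t) | p t. p \<in> places N \<and> t \<in> transitions N \<and> inp N t p > 0} \<union>
     {(Inr t, Inl p) | p t. p \<in> places N \<and> t \<in> transitions N \<and> out N t p > 0}"

definition strongly_connected_net :: "('p, 't) petri_net \<Rightarrow> bool" where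
  "strongly_connected_net N \<longleftrightarrow> strongly_connected (places N <+> transitions N) (net_arcs N)"


section \<open>Ordered Pi-nets\<close>

text \<open>
  The levels are given by families \<open>P\<close> and \<open>T\<close>, of which only the members at indices
  \<open>1, ..., n\<close> are relevant. Blocks of a partition are not required to be nonempty unless stated.
\<close>

definition ordered_pi_net ::
  "nat \<Rightarrow> ('p, 't) petri_net \<Rightarrow> (nat \<Rightarrow> 'p set) \<Rightarrow> (nat \<Rightarrow> 't set) \<Rightarrow> bool" where
  "ordered_pi_net n N P T \<longleftrightarrow>
     n \<ge> 2 \<and> petri_net N \<and> weakly_reversible N \<and>
     places N = (\<Union>i\<in>{1..n}. P i) \<and> disjoint_family_on P {1..n} \<and>
     transitions N = (\<Union>i\<in>{1..n}. T i) \<and> disjoint_family_on T {1..n} \<and>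
     (\<forall>i\<in>{1..n}. P i \<noteq> {}) \<and>
     (\<forall>i\<in>{1..n}. state_machine (restrict_net N (P i) (T i)) \<and>
        strongly_connected_net (restrict_net N (P i) (T i))) \<and>
     (\<forall>i\<in>{1..n}. \<forall>t\<in>T i. \<forall>p. inp N t p > 0 \<longrightarrow> p \<in> P i \<or> (i \<ge> 2 \<and> p \<in> P (i - 1))) \<and>
     (\<forall>i\<in>{2..n}. \<exists>t\<in>T i. \<exists>p\<in>P (i - 1). inp N t p > 0) \<and>
     (\<forall>i\<in>{1..n}. \<forall>t\<in>T i. \<forall>t'\<in>T i.
        (\<exists>p\<in>P i. inp N t p > 0 \<and> inp N t' p > 0) \<longrightarrow> inp N t = inp N t')"

text \<open>
  \<open>pot2 N T i p q\<close> is meant for \<open>p\<close> of level \<open>i \<ge> 2\<close> and \<open>q\<close> of level \<open>i - 1\<close>.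
  In an ordered Pi-net the value does not depend on the chosen transition.
\<close>

definition pot2 :: "('p, 't) petri_net \<Rightarrow> (nat \<Rightarrow> 't set) \<Rightarrow> nat \<Rightarrow> 'p \<Rightarrow> 'p \<Rightarrow> nat" where
  "pot2 N T i p q =
     (if \<exists>t\<in>T i. out N t p > 0 \<and> out N t q > 0
      then out N (SOME t. t \<in> T i \<and> out N t p > 0 \<and> out N t q > 0) q
      else 0)"

text \<open>The potential of a place \<open>p\<close> of level \<open>i\<close>.\<close>

definition pot ::
  "('p, 't) petri_net \<Rightarrow> (nat \<Rightarrow> 'p set) \<Rightarrow> (nat \<Rightarrow> 't set) \<Rightarrow> nat \<Rightarrow> 'p \<Rightarrow> nat" where
  "pot N P T i p = (if i \<ge> 2 then \<Sum>q\<in>P (i - 1). pot2 N T i p q else 0)"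

definition pi3_net ::
  "nat \<Rightarrow> ('p, 't) petri_net \<Rightarrow> (nat \<Rightarrow> 'p set) \<Rightarrow> (nat \<Rightarrow> 't set) \<Rightarrow> bool" where
  "pi3_net n N P T \<longleftrightarrow>
     ordered_pi_net n N P T \<and>
     (\<forall>i\<in>{1..n-1}. \<forall>p\<in>P i.
        (\<exists>t\<in>T (i + 1). inp N t p > 0) \<longrightarrow> pot N P T i p = Max (pot N P T i ` P i))"

definition phi ::
  "('p, 't) petri_net \<Rightarrow> (nat \<Rightarrow> 'p set) \<Rightarrow> (nat \<Rightarrow> 't set) \<Rightarrow> nat \<Rightarrow> ('p \<Rightarrow> nat) \<Rightarrow> nat" where
  "phi N P T i m =
     (if (\<Sum>p\<in>P i. m p) = 0
      then Max (pot N P T i ` P i)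
      else Min (pot N P T i ` {p \<in> P i. m p > 0}))"

definition n_condition ::
  "nat \<Rightarrow> ('p, 't) petri_net \<Rightarrow> (nat \<Rightarrow> 'p set) \<Rightarrow> (nat \<Rightarrow> 't set) \<Rightarrow> ('p \<Rightarrow> nat) \<Rightarrow> bool" where
  "n_condition n N P T m \<longleftrightarrow>
     (\<Sum>p\<in>P n. m p) > 0 \<and> (\<forall>j\<in>{2..n}. (\<Sum>p\<in>P (j - 1). m p) \<ge> phi N P T j m)"

text \<open>
  \<open>witness n N P T m i p\<close> is the value of the marking witness of \<open>m\<close> at a place \<open>p\<close> of
  level \<open>i\<close>. The tuples \<open>r\<^sub>1, ..., r\<^sub>j\<close> are the extensional functions on \<open>{1..j}\<close>
  with \<open>r k\<close> of level \<open>i + k\<close>.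
\<close>

definition witness ::
  "nat \<Rightarrow> ('p, 't) petri_net \<Rightarrow> (nat \<Rightarrow> 'p set) \<Rightarrow> (nat \<Rightarrow> 't set) \<Rightarrow>
   ('p \<Rightarrow> int) \<Rightarrow> nat \<Rightarrow> 'p \<Rightarrow> int" where
  "witness n N P T m i p =
     m p + (\<Sum>j=1..n-i. (-1) ^ j *
       (\<Sum>r\<in>(\<Pi>\<^sub>E k\<in>{1..j}. P (i + k)).
          m (r j) * (\<Prod>k=1..j-1. int (pot2 N T (i + k + 1) (r (k + 1)) (r k))) *
          int (pot2 N T (i + 1) (r 1) p)))"

definition witness_sum ::
  "nat \<Rightarrow> ('p, 't) petri_net \<Rightarrow> (nat \<Rightarrow> 'p set) \<Rightarrow> (nat \<Rightarrow> 't set) \<Rightarrow>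
   ('p \<Rightarrow> nat) \<Rightarrow> nat \<Rightarrow> int" where
  "witness_sum n N P T m i = (\<Sum>p\<in>P i. witness n N P T (\<lambda>q. int (m q)) i p)"

definition S_set ::
  "nat \<Rightarrow> ('p, 't) petri_net \<Rightarrow> (nat \<Rightarrow> 'p set) \<Rightarrow> (nat \<Rightarrow> 't set) \<Rightarrow>
   ('p \<Rightarrow> nat) \<Rightarrow> ('p \<Rightarrow> nat) set" where
  "S_set n N P T m0 =
     {m \<in> markings N. n_condition n N P T m \<and>
        (\<forall>i\<in>{1..n}. witness_sum n N P T m i = witness_sum n N P T m0 i)}"

end

theory Submission
  imports Defs
begin

text \<open>
  By weak reversibility every place \<open>p\<close> of level \<open>i\<close> carries a complex \<open>cx i p\<close>, consisting of
  one token at \<open>p\<close> and of \<open>pot p\<close> tokens at level \<open>i - 1\<close>, and reachability amounts to exchanging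
  complexes of the same level, a reversible operation. Such an exchange preserves the witness sums, and it
  preserves each inequality of the n-condition in both directions because the complexes of level \<open>j + 1\<close>
  meet level \<open>j\<close> in places of maximal potential only. If an inequality fails at level \<open>j\<close>, no transition
  of \<open>T j\<close> is ever enabled, so live markings satisfy the n-condition.

  Conversely, under the n-condition one can gather all tokens of a level at places of maximal potential,
  in any prescribed distribution, using only transitions of this level and of lower ones. Two markings of
  the set \<open>S\<close> are thus brought to agree level by level from the top: once they agree above level \<open>i\<close>,
  equality of the witness sums forces equal token counts at level \<open>i\<close>.
\<close>

section \<open>Recursion for the marking witness\<close>

text \<open>A tuple amounts to its head and its shifted tail. In the witness formula this isolates
  r_1, the place one level up.\<close>

lemma sum_PiE_shift:
  fixes f :: "'a \<Rightarrow> (nat \<Rightarrow> 'a) \<Rightarrow> 'b::comm_monoid_add"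
  shows "(\<Sum>r\<in>(\<Pi>\<^sub>E k\<in>{1..Suc j}. A k). f (r 1) (\<lambda>k\<in>{1..j}. r (Suc k)))
       = (\<Sum>a\<in>A 1. \<Sum>r\<in>(\<Pi>\<^sub>E k\<in>{1..j}. A (Suc k)). f a r)"
proof -
  have "(\<Sum>a\<in>A 1. \<Sum>r\<in>(\<Pi>\<^sub>E k\<in>{1..j}. A (Suc k)). f a r)
      = (\<Sum>(a, r)\<in>A 1 \<times> (\<Pi>\<^sub>E k\<in>{1..j}. A (Suc k)). f a r)"
    by (simp add: sum.cartesian_product)
  also have "\<dots> = (\<Sum>r\<in>(\<Pi>\<^sub>E k\<in>{1..Suc j}. A k). f (r 1) (\<lambda>k\<in>{1..j}. r (Suc k)))"
  \<comment> \<open>The value \<open>undefined\<close> outside \<open>{1..Suc j}\<close> keeps the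
    rebuilt tuple extensional.\<close>
  proof (rule sum.reindex_bij_witness[where
        j = "\<lambda>(a, r) k. if k = 1 then a else if k \<in> {1..Suc j} then r (k - 1) else undefined" and
        i = "\<lambda>r. (r 1, \<lambda>k\<in>{1..j}. r (Suc k))"], goal_cases)
    case (1 x)
    then show ?case
      by (auto simp: fun_eq_iff restrict_def PiE_def extensional_def)
  next
    case (2 x)
    then obtain a r where x: "x = (a, r)" "a \<in> A 1" "\<And>k. k \<in> {1..j} \<Longrightarrow> r k \<in> A (Suc k)"
      by (auto simp: PiE_iff)
    have "r (k - 1) \<in> A k" if "k \<in> {1..Suc j}" "k \<noteq> 1" for k
    proof -
      have "k - 1 \<in> {1..j}" "Suc (k - 1) = k" using that by auto
      then show ?thesis using x(3)[of "k - 1"] by simp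
    qed
    then show ?case
      using x(2) by (auto simp: x(1) PiE_iff extensional_def)
  next
    case (3 r)
    show ?case
    proof
      fix k
      consider "k = 1" | "k \<in> {1..Suc j}" "k \<noteq> 1" | "k \<notin> {1..Suc j}" by blast
      then show "(case (r 1, \<lambda>k\<in>{1..j}. r (Suc k)) of (a, r) \<Rightarrow> \<lambda>k. if k = 1 then a else
          if k \<in> {1..Suc j} then r (k - 1) else undefined) k = r k"
      proof cases
        case 2
        then have "k - 1 \<in> {1..j}" "Suc (k - 1) = k" by auto
        with 2 show ?thesis by simp
      next
        case 3
        then have "r k = undefined" using PiE_arb[OF \<open>r \<in> _\<close>] by blast
        with 3 show ?thesis by auto
      qed simp
    qed
  next
    case (4 r)
    have r: "r k \<in> A k" if "k \<in> {1..Suc j}" for k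
      using 4 that by (rule PiE_mem)
    have "r 1 \<in> A 1"
      by (rule r) simp
    moreover have "(\<lambda>k\<in>{1..j}. r (Suc k)) \<in> (\<Pi>\<^sub>E k\<in>{1..j}. A (Suc k))"
      by (rule restrict_PiE_iff[THEN iffD2]) (simp add: r)
    ultimately show ?case
      by (rule SigmaI)
  next
    case (5 x)
    then obtain a r where x: "x = (a, r)" "r \<in> extensional {1..j}"
      unfolding PiE_def by blast
    then have "(\<lambda>k\<in>{1..j}. r k) = r"
      by (simp add: extensional_restrict)
    moreover have "(\<lambda>k\<in>{1..j}. if Suc k = 1 then a else if Suc k \<in> {1..Suc j} then r (Suc k - 1)
        else undefined) = (\<lambda>k\<in>{1..j}. r k)"
      by (rule restrict_ext) auto
    ultimately show ?case
      by (simp add: x(1))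
  qed
  finally show ?thesis ..
qed

text \<open>Grouping the tuples by the value of r_1 leaves the alternating sum of the witness one
  level up, with one factor -1 to spare.\<close>

lemma witness_rec:
  assumes "i < n"
  shows "witness n N P T m i p
       = m p - (\<Sum>a\<in>P (Suc i). witness n N P T m (Suc i) a * int (pot2 N T (Suc i) a p))"
proof -
  define w where "w i j r p = m (r j) *
      (\<Prod>k=1..j-1. int (pot2 N T (i + k + 1) (r (k + 1)) (r k))) * int (pot2 N T (i + 1) (r 1) p)"
    for i j p and r :: "nat \<Rightarrow> 'a"
  define S where "S i j p = (\<Sum>r\<in>(\<Pi>\<^sub>E k\<in>{1..j}. P (i + k)). w i j r p)" for i j p
  have wit: "witness n N P T m i p = m p + (\<Sum>j=1..n-i. (-1) ^ j * S i j p)" for i p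
    unfolding witness_def S_def w_def ..
  \<comment> \<open>Length one is done apart: the leading term \<open>m a\<close> of the witness one
    level up is not of the form \<open>S (Suc i) 0 a\<close>.\<close>
  have S1: "S i 1 p = (\<Sum>a\<in>P (Suc i). m a * int (pot2 N T (Suc i) a p))"
  proof -
    have "S i 1 p = (\<Sum>r\<in>(\<Pi>\<^sub>E k\<in>{1..Suc 0}. P (i + k)).
        (\<lambda>a _. m a * int (pot2 N T (Suc i) a p)) (r 1) (\<lambda>k\<in>{1..0}. r (Suc k)))"
      unfolding S_def w_def by simp
    also have "\<dots> = (\<Sum>a\<in>P (i + 1). \<Sum>r\<in>(\<Pi>\<^sub>E k\<in>{1..0}. P (i + Suc k)).
        m a * int (pot2 N T (Suc i) a p))"
      by (rule sum_PiE_shift)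
    finally show ?thesis by simp
  qed
  have SS: "S i (Suc j) p = (\<Sum>a\<in>P (Suc i). S (Suc i) j a * int (pot2 N T (Suc i) a p))"
    if "j \<ge> 1" for j
  proof -
    have "w i (Suc j) r p = w (Suc i) j (\<lambda>k\<in>{1..j}. r (Suc k)) (r 1) * int (pot2 N T (Suc i) (r 1) p)" for r
    proof -
      obtain j' where j': "j = Suc j'" using \<open>j \<ge> 1\<close> by (cases j) auto
      have "(\<Prod>k=1..j. int (pot2 N T (i + k + 1) (r (k + 1)) (r k)))
          = int (pot2 N T (i + 2) (r 2) (r 1)) *
            (\<Prod>k=1..j'. int (pot2 N T (Suc i + k + 1) (r (Suc k + 1)) (r (Suc k))))"
        unfolding j' using prod.atLeast_Suc_atMost[of 1 "Suc j'" "\<lambda>k. int (pot2 N T (i + k + 1) (r (k + 1)) (r k))"]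
          prod.shift_bounds_cl_Suc_ivl[of "\<lambda>k. int (pot2 N T (i + k + 1) (r (k + 1)) (r k))" 1 j']
        by (simp add: numeral_2_eq_2)
      moreover have "(\<Prod>k=1..j'. int (pot2 N T (Suc i + k + 1) (r (Suc k + 1)) (r (Suc k))))
          = (\<Prod>k=1..j'. int (pot2 N T (Suc i + k + 1)
               ((\<lambda>k\<in>{1..j}. r (Suc k)) (k + 1)) ((\<lambda>k\<in>{1..j}. r (Suc k)) k)))"
        by (rule prod.cong) (auto simp: j')
      ultimately show ?thesis
        using \<open>j \<ge> 1\<close> unfolding w_def by (simp add: j' numeral_2_eq_2 mult_ac)
    qed
    then have "S i (Suc j) p = (\<Sum>r\<in>(\<Pi>\<^sub>E k\<in>{1..Suc j}. P (i + k)).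
        (\<lambda>a r. w (Suc i) j r a * int (pot2 N T (Suc i) a p)) (r 1) (\<lambda>k\<in>{1..j}. r (Suc k)))"
      unfolding S_def by simp
    also have "\<dots> = (\<Sum>a\<in>P (i + 1). \<Sum>r\<in>(\<Pi>\<^sub>E k\<in>{1..j}. P (i + Suc k)).
        w (Suc i) j r a * int (pot2 N T (Suc i) a p))"
      by (rule sum_PiE_shift)
    finally show ?thesis
      by (simp add: S_def sum_distrib_right)
  qed
  have ni: "n - i = Suc (n - Suc i)" using assms by simp
  have "(\<Sum>j=1..n-i. (-1) ^ j * S i j p)
      = - S i 1 p + (\<Sum>j=1..n - Suc i. (-1) ^ Suc j * S i (Suc j) p)"
    unfolding ni
    using sum.atLeast_Suc_atMost[of 1 "Suc (n - Suc i)" "\<lambda>j. (-1) ^ j * S i j p"]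
      sum.shift_bounds_cl_Suc_ivl[of "\<lambda>j. (-1) ^ j * S i j p" 1 "n - Suc i"]
    by simp
  also have "(\<Sum>j=1..n - Suc i. (-1) ^ Suc j * S i (Suc j) p)
      = (\<Sum>j=1..n - Suc i. \<Sum>a\<in>P (Suc i). - ((-1) ^ j * S (Suc i) j a * int (pot2 N T (Suc i) a p)))"
    by (rule sum.cong) (auto simp: SS sum_distrib_left sum_negf mult.assoc)
  also have "\<dots> = - (\<Sum>a\<in>P (Suc i). (\<Sum>j=1..n - Suc i. (-1) ^ j * S (Suc i) j a) * int (pot2 N T (Suc i) a p))"
    by (subst sum.swap) (simp add: sum_negf sum_distrib_right)
  finally show ?thesis
    unfolding wit S1 by (simp add: sum.distrib distrib_right)
qed

lemma witness_top: "witness n N P T m n p = m p"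
  by (simp add: witness_def)

text \<open>Linearity of the witness, in the shape needed for replacing a complex \<open>a\<close>
  by a complex \<open>b\<close>.\<close>

lemma witness_exchange:
  assumes "\<And>q. m' q = m q - a q + b q"
  shows "witness n N P T m' i p = witness n N P T m i p - witness n N P T a i p + witness n N P T b i p"
  unfolding witness_def assms
  by (simp add: sum.distrib sum_subtractf distrib_right distrib_left left_diff_distrib right_diff_distrib)

text \<open>The correction term at level \<open>i\<close> reads the marking strictly above
  \<open>i\<close> only. Hence, for markings that agree there, equal witness sums will mean equal
  token counts at level \<open>i\<close>.\<close>

lemma witness_diff_cong:
  assumes "\<And>k x. \<lbrakk>i < k; k \<le> n; x \<in> P k\<rbrakk> \<Longrightarrow> m x = m' x"
  shows "witness n N P T m i p - m p = witness n N P T m' i p - m' p"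
proof -
  have "m (r j) = m' (r j)" if "j \<in> {1..n-i}" "r \<in> (\<Pi>\<^sub>E k\<in>{1..j}. P (i + k))" for j r
    using that by (intro assms[of "i + j"]) auto
  then show ?thesis
    unfolding witness_def by simp
qed

section \<open>Complexes\<close>

locale pi3 =
  fixes n :: nat and N :: "('p, 't) petri_net" and P :: "nat \<Rightarrow> 'p set" and T :: "nat \<Rightarrow> 't set"
  assumes pi3: "pi3_net n N P T"
begin

section \<open>Levels and the axioms of the net\<close>

lemma opn: "ordered_pi_net n N P T"
  using pi3 by (simp add: pi3_net_def)

lemma n_ge_2: "n \<ge> 2"
  and finite_places: "finite (places N)"
  and weakly_rev: "weakly_reversible N"
  and places_eq: "places N = (\<Union>i\<in>{1..n}. P i)"
  and P_disj: "disjoint_family_on P {1..n}"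
  and transitions_eq: "transitions N = (\<Union>i\<in>{1..n}. T i)"
  using opn unfolding ordered_pi_net_def petri_net_def by blast+

lemma
  assumes "i \<in> {1..n}"
  shows P_nonempty: "P i \<noteq> {}"
    and machine: "state_machine (restrict_net N (P i) (T i))"
    and machine_connected: "strongly_connected_net (restrict_net N (P i) (T i))"
proof -
  have "\<forall>i\<in>{1..n}. P i \<noteq> {}"
    using opn unfolding ordered_pi_net_def by (elim conjE)
  then show "P i \<noteq> {}" using assms by blast
  have "\<forall>i\<in>{1..n}. state_machine (restrict_net N (P i) (T i)) \<and>
      strongly_connected_net (restrict_net N (P i) (T i))"
    using opn unfolding ordered_pi_net_def by (elim conjE)
  then show "state_machine (restrict_net N (P i) (T i))"
    and "strongly_connected_net (restrict_net N (P i) (T i))"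
    using assms by blast+
qed

lemma P_places: "i \<in> {1..n} \<Longrightarrow> x \<in> P i \<Longrightarrow> x \<in> places N"
  unfolding places_eq by blast

lemma finite_P: "i \<in> {1..n} \<Longrightarrow> finite (P i)"
  by (rule finite_subset[OF _ finite_places]) (blast intro: P_places)

lemma P_disjoint: "\<lbrakk>i \<in> {1..n}; j \<in> {1..n}; x \<in> P i; x \<in> P j\<rbrakk> \<Longrightarrow> i = j"
  using P_disj unfolding disjoint_family_on_def by blast

lemma P_disjoint_pred:
  assumes "i \<in> {2..n}" "x \<in> P i"
  shows "x \<notin> P (i - 1)"
proof
  assume "x \<in> P (i - 1)"
  moreover have "i \<in> {1..n}" "i - 1 \<in> {1..n}" "i \<noteq> i - 1" using assms(1) by auto
  ultimately show False using P_disjoint assms(2) by blast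
qed

lemma inp_support:
  assumes "i \<in> {1..n}" "t \<in> T i" "inp N t p > 0"
  shows "p \<in> P i \<or> (i \<ge> 2 \<and> p \<in> P (i - 1))"
proof -
  have "\<forall>i\<in>{1..n}. \<forall>t\<in>T i. \<forall>p. inp N t p > 0 \<longrightarrow> p \<in> P i \<or> (i \<ge> 2 \<and> p \<in> P (i - 1))"
    using opn unfolding ordered_pi_net_def by (elim conjE)
  then show ?thesis using assms by blast
qed

lemma inp_eq:
  assumes "i \<in> {1..n}" "t \<in> T i" "t' \<in> T i" "p \<in> P i" "inp N t p > 0" "inp N t' p > 0"
  shows "inp N t = inp N t'"
proof -
  have "\<forall>i\<in>{1..n}. \<forall>t\<in>T i. \<forall>t'\<in>T i.
      (\<exists>p\<in>P i. inp N t p > 0 \<and> inp N t' p > 0) \<longrightarrow> inp N t = inp N t'"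
    using opn unfolding ordered_pi_net_def by (elim conjE)
  then show ?thesis using assms by blast
qed

lemma T_nonempty:
  assumes "i \<in> {2..n}"
  shows "T i \<noteq> {}"
proof -
  have "\<forall>i\<in>{2..n}. \<exists>t\<in>T i. \<exists>p\<in>P (i - 1). inp N t p > 0"
    using opn unfolding ordered_pi_net_def by (elim conjE)
  then show ?thesis using assms by blast
qed

lemma machine_inp_out:
  assumes "i \<in> {1..n}" "t \<in> T i"
  shows "\<exists>p\<in>P i. \<forall>q\<in>P i. inp N t q = (if q = p then 1 else 0)"
    and "\<exists>p\<in>P i. \<forall>q\<in>P i. out N t q = (if q = p then 1 else 0)"
proof -
  note sm = machine[OF assms(1)]
  then obtain p where p: "p \<in> P i"
    and e: "inp (restrict_net N (P i) (T i)) t = (\<lambda>q. if q = p then 1 else 0)"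
    using assms by (auto simp: state_machine_def restrict_net_def)
  have "inp N t q = (if q = p then 1 else 0)" if "q \<in> P i" for q
    using fun_cong[OF e, of q] that P_places[OF assms(1) that] by (simp add: inp_def restrict_net_def)
  with p show "\<exists>p\<in>P i. \<forall>q\<in>P i. inp N t q = (if q = p then 1 else 0)" by blast
  from sm obtain p where p: "p \<in> P i"
    and e: "out (restrict_net N (P i) (T i)) t = (\<lambda>q. if q = p then 1 else 0)"
    using assms by (auto simp: state_machine_def restrict_net_def)
  have "out N t q = (if q = p then 1 else 0)" if "q \<in> P i" for q
    using fun_cong[OF e, of q] that P_places[OF assms(1) that] by (simp add: out_def restrict_net_def)
  with p show "\<exists>p\<in>P i. \<forall>q\<in>P i. out N t q = (if q = p then 1 else 0)" by blast
qed

text \<open>The arc of \<open>t\<close> puts both its ends into one connected component, which is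
  strongly connected.\<close>

lemma reaction_return:
  assumes "t \<in> transitions N"
  shows "(out N t, inp N t) \<in> (reaction_arcs N)\<^sup>*"
proof -
  let ?V = "reaction_nodes N" and ?E = "reaction_arcs N"
  let ?R = "((?E \<union> ?E\<inverse>)\<^sup>*) \<inter> ?V \<times> ?V"
  have V: "inp N t \<in> ?V" "out N t \<in> ?V" and E: "(inp N t, out N t) \<in> ?E"
    using assms by (auto simp: reaction_nodes_def reaction_arcs_def)
  then have "?R `` {inp N t} \<in> connected_components ?V ?E"
    by (auto simp: connected_components_def intro: quotientI)
  then have "strongly_connected (?R `` {inp N t}) ?E"
    using weakly_rev by (auto simp: weakly_reversible_def)
  moreover have "inp N t \<in> ?R `` {inp N t}" "out N t \<in> ?R `` {inp N t}"
    using V E by auto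
  ultimately have "(out N t, inp N t) \<in> (?E \<inter> (?R `` {inp N t}) \<times> (?R `` {inp N t}))\<^sup>*"
    unfolding strongly_connected_def by blast
  then show ?thesis
    by (rule rev_subsetD) (intro rtrancl_mono, blast)
qed

text \<open>Along reaction arcs the highest marked level never decreases, so it is constant on cycles.\<close>

lemma out_is_inp:
  assumes i: "i \<in> {1..n}" and t: "t \<in> T i"
  obtains t' where "t' \<in> T i" "out N t = inp N t'"
proof -
  \<comment> \<open>\<open>L i c\<close> says that \<open>c\<close> marks some level at or above
    \<open>i\<close>. By \<open>Linp\<close> the highest level marked by an input of
    \<open>T j\<close> is exactly \<open>j\<close>; for outputs only the lower bound
    \<open>Lout\<close> is known at first.\<close>
  define L where "L i c \<longleftrightarrow> (\<exists>k\<in>{i..n}. \<exists>p\<in>P k. c p > 0)" for i and c :: "'p \<Rightarrow> nat"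
  have Linp: "L i' (inp N s) \<longleftrightarrow> i' \<le> j" if "s \<in> T j" "j \<in> {1..n}" "i' \<ge> 1" for s i' j
  proof
    assume "L i' (inp N s)"
    then obtain k p where kp: "k \<in> {i'..n}" "p \<in> P k" "inp N s p > 0"
      by (auto simp: L_def)
    from inp_support[OF that(2,1) kp(3)] show "i' \<le> j"
    proof
      assume "p \<in> P j"
      then show ?thesis using P_disjoint[of k j p] kp that by auto
    next
      assume "j \<ge> 2 \<and> p \<in> P (j - 1)"
      moreover from this have "j - 1 \<in> {1..n}" using that by auto
      ultimately have "k = j - 1" using P_disjoint[of k "j - 1" p] kp that by auto
      then show ?thesis using kp by auto
    qed
  next
    assume "i' \<le> j"
    with machine_inp_out(1)[OF that(2,1)] that show "L i' (inp N s)"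
      unfolding L_def by (auto intro!: bexI[of _ j])
  qed
  have Lout: "L j (out N s)" if "s \<in> T j" "j \<in> {1..n}" for s j
    using machine_inp_out(2)[OF that(2,1)] that unfolding L_def by (auto intro!: bexI[of _ j])
  have Larc: "L i' c'" if cc: "(c, c') \<in> reaction_arcs N" and c: "L i' c" and i': "i' \<ge> 1" for c c' i'
  proof -
    obtain s j where s: "s \<in> T j" "j \<in> {1..n}" "c = inp N s" "c' = out N s"
      using cc by (auto simp: reaction_arcs_def transitions_eq)
    have "i' \<le> j" using Linp[OF s(1,2) i'] c s(3) by simp
    then show ?thesis using Lout[OF s(1,2)] s(4) unfolding L_def by fastforce
  qed
  have Lpath: "L i' c'" if "(c, c') \<in> (reaction_arcs N)\<^sup>*" "L i' c" "i' \<ge> 1" for c c' i'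
    using that by (induction rule: rtrancl_induct) (auto intro: Larc)
  have "t \<in> transitions N" using i t by (auto simp: transitions_eq)
  from reaction_return[OF this] show thesis
  proof (cases rule: converse_rtranclE)
    case base
    then show ?thesis using that t by simp
  next
    \<comment> \<open>The first arc of the path from \<open>out N t\<close> back to
      \<open>inp N t\<close> supplies the transition \<open>s\<close> that consumes
      \<open>out N t\<close>. Comparing highest levels at both ends of the path yields
      \<open>j = i\<close>.\<close>
    case (step c)
    obtain s j where s: "s \<in> T j" "j \<in> {1..n}" "out N t = inp N s" "c = out N s"
      using step(1) by (auto simp: reaction_arcs_def transitions_eq)
    have "i \<le> j" using Lout[OF t i] Linp[OF s(1,2), of i] i s(3) by simp
    moreover have "j \<le> i"
      using Lpath[OF step(2), of j] Lout[OF s(1,2)] s(2,4) Linp[OF t i, of j] by simp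
    ultimately show ?thesis using that s by simp
  qed
qed

text \<open>Built from \<open>pot2\<close> and not from a chosen transition, so that it also makes
  sense for a one-place bottom level without transitions. The guard on \<open>i\<close> is there
  because \<open>P 0\<close> is an arbitrary set.\<close>

definition cx :: "nat \<Rightarrow> 'p \<Rightarrow> 'p \<Rightarrow> nat" where
  "cx i p x = (if x = p then 1 else 0) + (if i \<ge> 2 \<and> x \<in> P (i - 1) then pot2 N T i p x else 0)"

abbreviation arcs :: "nat \<Rightarrow> (('p + 't) \<times> ('p + 't)) set" where
  "arcs i \<equiv> net_arcs (restrict_net N (P i) (T i))"

lemma arcs_iff:
  assumes "i \<in> {1..n}"
  shows "(Inl p, Inr t) \<in> arcs i \<longleftrightarrow> p \<in> P i \<and> t \<in> T i \<and> inp N t p > 0"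
    and "(Inr t, Inl p) \<in> arcs i \<longleftrightarrow> p \<in> P i \<and> t \<in> T i \<and> out N t p > 0"
    and "(Inl p, Inl q) \<notin> arcs i" and "(Inr t, Inr t') \<notin> arcs i"
  using P_places[OF assms]
  by (auto simp: net_arcs_def restrict_net_def inp_def out_def)

lemma arcs_connected:
  assumes "i \<in> {1..n}" "x \<in> P i <+> T i" "y \<in> P i <+> T i"
  shows "(x, y) \<in> (arcs i)\<^sup>*"
proof -
  from machine_connected[OF assms(1)] have "(x, y) \<in> (arcs i \<inter> (P i <+> T i) \<times> (P i <+> T i))\<^sup>*"
    using assms(2,3) by (simp add: strongly_connected_net_def strongly_connected_def restrict_net_def)
  then show ?thesis
    by (rule rev_subsetD) (intro rtrancl_mono, blast)
qed

text \<open>A path from any transition of the machine to \<open>p\<close> must enter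
  \<open>p\<close> through a producer.\<close>

lemma producer_exists:
  assumes "i \<in> {1..n}" "p \<in> P i" "T i \<noteq> {}"
  obtains t where "t \<in> T i" "out N t p > 0"
proof -
  obtain s where "s \<in> T i" using assms(3) by blast
  then have "(Inr s, Inl p) \<in> (arcs i)\<^sup>*"
    using assms by (intro arcs_connected) auto
  then show thesis
  proof (cases rule: rtranclE)
    case (step y)
    then show ?thesis
      using that arcs_iff[OF assms(1)] by (cases y) auto
  qed auto
qed

text \<open>By \<open>out_is_inp\<close> the output of each producer of \<open>p\<close> is the
  input of a consumer of \<open>p\<close>, and all consumers of \<open>p\<close> in
  \<open>T i\<close> share one input. So every producer outputs \<open>inp N t\<close>, whatever
  transition \<open>pot2\<close> chooses.\<close>

lemma inp_eq_cx:
  assumes i: "i \<in> {1..n}" and t: "t \<in> T i" and p: "p \<in> P i" and tp: "inp N t p > 0"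
  shows "inp N t = cx i p"
proof
  fix x
  have out_p: "out N s = inp N t" if s: "s \<in> T i" "out N s p > 0" for s
  proof -
    obtain s' where "s' \<in> T i" "out N s = inp N s'"
      using out_is_inp[OF i s(1)] .
    then show ?thesis using inp_eq[OF i _ t p] s(2) tp by metis
  qed
  obtain s where s: "s \<in> T i" "out N s p > 0"
    using producer_exists[OF i p] t by blast
  have pot2: "pot2 N T i p x = inp N t x"
  proof (cases "inp N t x > 0")
    case True
    then have ex: "\<exists>s. s \<in> T i \<and> out N s p > 0 \<and> out N s x > 0"
      using s out_p by metis
    then have "out N (SOME t. t \<in> T i \<and> out N t p > 0 \<and> out N t x > 0) = inp N t"
      using someI_ex[OF ex] out_p by blast
    then show ?thesis using ex by (auto simp: pot2_def)
  next
    \<comment> \<open>No producer of \<open>p\<close> outputs to \<open>x\<close> either, so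
      \<open>pot2\<close> takes its default value 0.\<close>
    case False
    then show ?thesis using out_p by (auto simp: pot2_def)
  qed
  obtain p' where "p' \<in> P i" "\<forall>q\<in>P i. inp N t q = (if q = p' then 1 else 0)"
    using machine_inp_out(1)[OF i t] by blast
  then have mach: "\<forall>q\<in>P i. inp N t q = (if q = p then 1 else 0)"
    using p tp by (metis less_irrefl)
  show "inp N t x = cx i p x"
  proof (cases "x \<in> P i")
    case True
    then have "\<not> (i \<ge> 2 \<and> x \<in> P (i - 1))"
      using P_disjoint_pred[of i x] i by auto
    then show ?thesis using mach True by (auto simp: cx_def)
  next
    case False
    then have "x \<noteq> p" using p by blast
    show ?thesis
      using inp_support[OF i t, of x] False \<open>x \<noteq> p\<close> pot2 by (auto simp: cx_def)
  qed
qed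

lemma out_eq_cx:
  assumes "i \<in> {1..n}" "t \<in> T i" "p \<in> P i" "out N t p > 0"
  shows "out N t = cx i p"
  using out_is_inp[OF assms(1,2)] inp_eq_cx[OF assms(1) _ assms(3)] assms(4) by metis

lemma cx_level:
  assumes "i \<in> {1..n}" "p \<in> P i" "x \<in> P i"
  shows "cx i p x = (if x = p then 1 else 0)"
  using P_disjoint_pred[of i x] assms by (auto simp: cx_def)

lemma cx_below:
  assumes "i \<in> {2..n}" "p \<in> P i" "x \<in> P (i - 1)"
  shows "cx i p x = pot2 N T i p x"
  using P_disjoint_pred[of i x] assms by (auto simp: cx_def)

lemma cx_other:
  assumes "i \<in> {1..n}" "p \<in> P i" "x \<notin> P i" "i = 1 \<or> x \<notin> P (i - 1)"
  shows "cx i p x = 0"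
  using assms by (auto simp: cx_def)

lemma cx_other_level:
  assumes "i \<in> {1..n}" "p \<in> P i" "k \<in> {1..n}" "x \<in> P k" "k \<noteq> i" "Suc k \<noteq> i"
  shows "cx i p x = 0"
proof (rule cx_other[OF assms(1,2)])
  show "x \<notin> P i" using P_disjoint[of k i x] assms by blast
  show "i = 1 \<or> x \<notin> P (i - 1)"
  proof (rule disjCI)
    assume "\<not> x \<notin> P (i - 1)"
    moreover have "k \<noteq> i - 1" using assms(6,1) by auto
    ultimately have "i - 1 \<notin> {1..n}" using P_disjoint[of k "i - 1" x] assms(3,4) by blast
    then show "i = 1" using assms(1) by auto
  qed
qed

lemma cx_outside:
  assumes "i \<in> {1..n}" "p \<in> P i" "x \<notin> places N"
  shows "cx i p x = 0"
proof (rule cx_other[OF assms(1,2)])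
  show "x \<notin> P i" using assms by (auto simp: places_eq)
  have "i - 1 \<in> {1..n} \<or> i = 1" using assms(1) by auto
  then show "i = 1 \<or> x \<notin> P (i - 1)" using P_places assms(3) by blast
qed

lemma pot_eq:
  assumes "i \<in> {2..n}" "p \<in> P i"
  shows "pot N P T i p = (\<Sum>x\<in>P (i - 1). cx i p x)"
  using assms by (auto simp: pot_def cx_below)

definition max_pot :: "nat \<Rightarrow> nat" where
  "max_pot i = Max (pot N P T i ` P i)"

lemma pot_le_max: "i \<in> {1..n} \<Longrightarrow> p \<in> P i \<Longrightarrow> pot N P T i p \<le> max_pot i"
  by (auto simp: max_pot_def finite_P)

lemma max_pot_attained:
  assumes "i \<in> {1..n}"
  obtains h where "h \<in> P i" "pot N P T i h = max_pot i"
proof -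
  have "max_pot i \<in> pot N P T i ` P i"
    unfolding max_pot_def using P_nonempty[OF assms] finite_P[OF assms] by (intro Max_in) auto
  then show thesis using that by force
qed

text \<open>The condition special to \<open>pi3_net\<close> speaks of inputs only. The complex of
  \<open>p\<close> is the output of a producer, hence also the input of some transition of
  \<open>T i\<close>, to which the condition applies.\<close>

lemma cx_below_max_pot:
  assumes i: "i \<in> {2..n}" and p: "p \<in> P i" and x: "x \<in> P (i - 1)" "cx i p x > 0"
  shows "pot N P T (i - 1) x = max_pot (i - 1)"
proof -
  have i1: "i \<in> {1..n}" using i by simp
  obtain t where t: "t \<in> T i" "out N t p > 0"
    using producer_exists[OF i1 p T_nonempty[OF i]] .
  then obtain t' where t': "t' \<in> T i" "out N t = inp N t'"
    using out_is_inp[OF i1 t(1)] by blast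
  then have "inp N t' x > 0" using out_eq_cx[OF i1 t(1) p t(2)] x(2) by simp
  then have "\<exists>t\<in>T (i - 1 + 1). inp N t x > 0" using t' i by auto
  moreover have "i - 1 \<in> {1..n-1}" using i by auto
  ultimately show ?thesis
    using pi3 x(1) unfolding pi3_net_def max_pot_def by blast
qed

section \<open>Exchanging complexes\<close>

text \<open>No single transition need lead from \<open>p\<close> to \<open>q\<close>; this freedom
  makes the relation symmetric.\<close>

definition exch :: "nat \<Rightarrow> 'p \<Rightarrow> 'p \<Rightarrow> ('p \<Rightarrow> nat) \<Rightarrow> ('p \<Rightarrow> nat) \<Rightarrow> bool" where
  "exch i p q m m' \<longleftrightarrow>
     p \<in> P i \<and> q \<in> P i \<and> (\<forall>x. cx i p x \<le> m x) \<and> m' = (\<lambda>x. m x - cx i p x + cx i q x)"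

lemma exch_sym:
  assumes "exch i p q m m'"
  shows "exch i q p m' m"
proof -
  have le: "cx i p x \<le> m x" and m': "m' = (\<lambda>x. m x - cx i p x + cx i q x)" for x
    using assms by (simp_all add: exch_def)
  have "m x = m' x - cx i q x + cx i p x" "cx i q x \<le> m' x" for x
    using le[of x] by (simp_all add: m')
  then show ?thesis using assms by (auto simp: exch_def)
qed

lemma fires_imp_exch:
  assumes "fires N m m'"
  obtains i p q where "i \<in> {1..n}" "exch i p q m m'"
proof -
  obtain t i where t: "i \<in> {1..n}" "t \<in> T i" "enabled N m t"
    and m': "m' = (\<lambda>p. m p - inp N t p + out N t p)"
    using assms by (auto simp: fires_def transitions_eq)
  obtain p q where "p \<in> P i" "q \<in> P i" "inp N t p > 0" "out N t q > 0"
    using machine_inp_out[OF t(1,2)] by (metis zero_less_one)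
  then have "exch i p q m m'"
    using t m' inp_eq_cx[OF t(1,2)] out_eq_cx[OF t(1,2)] by (simp add: exch_def enabled_def)
  then show thesis using that t(1) by blast
qed

text \<open>Follow a path from \<open>p\<close> to \<open>q\<close> in the machine of level
  \<open>i\<close>: its transitions carry the complex from place to place, while the remainder of
  \<open>m\<close> stays put.\<close>

lemma exch_imp_fires:
  assumes i: "i \<in> {1..n}" and ex: "exch i p q m m'"
  shows "(fires N)\<^sup>*\<^sup>* m m'"
proof -
  \<comment> \<open>The complex held at a node of the path. A transition node still holds its input,
    so only arcs from a transition to a place are firings.\<close>
  define c where "c y = (case y of Inl x \<Rightarrow> cx i x | Inr t \<Rightarrow> inp N t)" for y
  have pq: "p \<in> P i" "q \<in> P i" "\<And>x. cx i p x \<le> m x" "m' = (\<lambda>x. m x - cx i p x + cx i q x)"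
    using ex by (auto simp: exch_def)
  have "(Inl p, y) \<in> (arcs i)\<^sup>* \<Longrightarrow> (fires N)\<^sup>*\<^sup>* m (\<lambda>x. m x - cx i p x + c y x)" for y
  proof (induction rule: rtrancl_induct)
    case base
    have "(\<lambda>x. m x - cx i p x + c (Inl p) x) = m" using pq(3) by (auto simp: c_def)
    then show ?case by simp
  next
    case (step y z)
    show ?case
    proof (cases y)
      case (Inl a)
      then obtain t where z: "z = Inr t" using step(2) arcs_iff[OF i] by (cases z) auto
      have "a \<in> P i \<and> t \<in> T i \<and> inp N t a > 0" using step(2) arcs_iff(1)[OF i] unfolding Inl z by simp
      then have "c z = c y" using inp_eq_cx[OF i] by (simp add: c_def Inl z)
      then show ?thesis using step.IH by simp
    next
      case (Inr t)
      then obtain a where z: "z = Inl a" using step(2) arcs_iff[OF i] by (cases z) auto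
      have a: "a \<in> P i" "t \<in> T i" "out N t a > 0" using step(2) arcs_iff(2)[OF i] unfolding Inr z by simp_all
      then have "c z = out N t" using out_eq_cx[OF i] by (simp add: c_def z)
      then have "fires N (\<lambda>x. m x - cx i p x + c y x) (\<lambda>x. m x - cx i p x + c z x)"
        using a(2) i by (auto simp: fires_def enabled_def transitions_eq c_def Inr intro!: bexI[of _ t])
      then show ?thesis using step.IH by simp
    qed
  qed
  from this[of "Inl q"] show ?thesis
    using arcs_connected[OF i, of "Inl p" "Inl q"] pq by (auto simp: c_def)
qed

text \<open>The bound \<open>l\<close> records that levels above \<open>l\<close> stay untouched,
  which is what lets one level be rearranged after the levels above it are settled.\<close>

definition step :: "nat \<Rightarrow> ('p \<Rightarrow> nat) \<Rightarrow> ('p \<Rightarrow> nat) \<Rightarrow> bool" where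
  "step l m m' \<longleftrightarrow> (\<exists>i\<in>{1..l}. \<exists>p q. exch i p q m m')"

lemma step_mono: "step l m m' \<Longrightarrow> l \<le> l' \<Longrightarrow> step l' m m'"
  unfolding step_def by (meson atLeastAtMost_iff le_trans)

lemma steps_mono: "(step l)\<^sup>*\<^sup>* m m' \<Longrightarrow> l \<le> l' \<Longrightarrow> (step l')\<^sup>*\<^sup>* m m'"
  by (rule mono_rtranclp[rule_format, of "step l" "step l'"]) (auto intro: step_mono)

lemma steps_sym: "(step l)\<^sup>*\<^sup>* m m' \<Longrightarrow> (step l)\<^sup>*\<^sup>* m' m"
  by (rule sympD[OF sym_rtrancl[to_pred]]) (auto simp: symp_def step_def dest: exch_sym)

lemma fires_eq_steps: "(fires N)\<^sup>*\<^sup>* = (step n)\<^sup>*\<^sup>*"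
proof (intro antisym predicate2I)
  fix m m' assume "(fires N)\<^sup>*\<^sup>* m m'"
  then show "(step n)\<^sup>*\<^sup>* m m'"
  proof (rule mono_rtranclp[rule_format, rotated])
    show "step n a b" if "fires N a b" for a b
      using fires_imp_exch[OF that] unfolding step_def by blast
  qed
next
  fix m m' assume "(step n)\<^sup>*\<^sup>* m m'"
  then show "(fires N)\<^sup>*\<^sup>* m m'"
  proof induction
    case (step y z)
    then have "(fires N)\<^sup>*\<^sup>* y z" unfolding step_def using exch_imp_fires by blast
    with step.IH show ?case by (rule rtranclp_trans)
  qed simp
qed

section \<open>Effect of an exchange on the levels\<close>

lemma exch_sum_level:
  assumes i: "i \<in> {1..n}" and ex: "exch i p q m m'"
  shows "(\<Sum>x\<in>P i. m' x) = (\<Sum>x\<in>P i. m x)"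
proof -
  have pq: "p \<in> P i" "q \<in> P i" "\<And>x. cx i p x \<le> m x" "m' = (\<lambda>x. m x - cx i p x + cx i q x)"
    using ex by (auto simp: exch_def)
  have one: "(\<Sum>x\<in>P i. cx i a x) = 1" if "a \<in> P i" for a
    using that finite_P[OF i] by (simp add: cx_level[OF i])
  have "(\<Sum>x\<in>P i. m' x) + (\<Sum>x\<in>P i. cx i p x) = (\<Sum>x\<in>P i. m x) + (\<Sum>x\<in>P i. cx i q x)"
    unfolding sum.distrib[symmetric]
  proof (intro sum.cong refl)
    show "m' x + cx i p x = m x + cx i q x" for x
      using pq(3)[of x] by (simp add: pq(4))
  qed
  then show ?thesis using one pq by simp
qed

lemma exch_other_level:
  assumes "i \<in> {1..n}" "exch i p q m m'" "k \<in> {1..n}" "x \<in> P k" "k \<noteq> i" "Suc k \<noteq> i"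
  shows "m' x = m x"
  using assms cx_other_level[of i _ k x] by (auto simp: exch_def)

lemma steps_above:
  assumes "(step l)\<^sup>*\<^sup>* m m'" "l < k" "k \<le> n" "x \<in> P k"
  shows "m' x = m x"
  using assms(1)
proof induction
  case (step m m')
  then obtain i p q where "i \<in> {1..l}" "exch i p q m m'" by (auto simp: step_def)
  then have "m' x = m x"
    using assms(2-) by (intro exch_other_level[of i p q m m' k]) auto
  with step.IH show ?case by simp
qed simp

lemma steps_outside:
  assumes "(step l)\<^sup>*\<^sup>* m m'" "l \<le> n" "x \<notin> places N"
  shows "m' x = m x"
  using assms(1)
proof induction
  case (step m m')
  then obtain i p q where "i \<in> {1..l}" "exch i p q m m'" by (auto simp: step_def)
  then have "m' x = m x"
    using assms(2-) cx_outside[of i _ x] by (auto simp: exch_def)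
  with step.IH show ?case by simp
qed simp

section \<open>Invariants\<close>

text \<open>The witness of a complex is a unit vector, by downward induction along
  \<open>witness_rec\<close>: one level below \<open>p\<close> the correction cancels the tokens of
  the complex, and further down there is nothing left to correct.\<close>

lemma witness_cx:
  assumes l: "l \<in> {1..n}" and p: "p \<in> P l" and i: "i \<in> {1..n}" and x: "x \<in> P i"
  shows "witness n N P T (\<lambda>y. int (cx l p y)) i x = (if i = l \<and> x = p then 1 else 0)"
proof -
  have "i \<le> n" using i by simp
  then show ?thesis
    using i x
  proof (induction i arbitrary: x rule: inc_induct)
    case base
    then show ?case
      using cx_level[OF l p] cx_other_level[OF l p, of n x] l by (cases "l = n") (auto simp: witness_top)
  next
    case (step i)
    have fin: "finite (P (Suc i))" using step by (intro finite_P) auto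
    have "(\<Sum>a\<in>P (Suc i). witness n N P T (\<lambda>y. int (cx l p y)) (Suc i) a * int (pot2 N T (Suc i) a x))
        = (\<Sum>a\<in>P (Suc i). if Suc i = l \<and> a = p then int (pot2 N T (Suc i) a x) else 0)"
      using step by (intro sum.cong) auto
    also have "\<dots> = (if Suc i = l then int (pot2 N T l p x) else 0)"
      using p fin by auto
    finally have rec: "witness n N P T (\<lambda>y. int (cx l p y)) i x
        = int (cx l p x) - (if Suc i = l then int (pot2 N T l p x) else 0)"
      using step(2) by (simp add: witness_rec)
    consider "Suc i = l" | "i = l" | "Suc i \<noteq> l" "i \<noteq> l" by blast
    then show ?case
    proof cases
      case 1
      then show ?thesis using rec cx_below[of l p x] p l step by auto
    next
      case 2
      then show ?thesis using rec cx_level[OF l p] step by auto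
    next
      case 3
      then show ?thesis using rec cx_other_level[OF l p, of i x] step by auto
    qed
  qed
qed

text \<open>By linearity, since the removed and the added complex both contribute 1 at level
  \<open>l\<close> and 0 elsewhere.\<close>

lemma exch_witness_sum:
  assumes l: "l \<in> {1..n}" and ex: "exch l p q m m'" and i: "i \<in> {1..n}"
  shows "witness_sum n N P T m' i = witness_sum n N P T m i"
proof -
  have pq: "p \<in> P l" "q \<in> P l" "\<And>x. cx l p x \<le> m x" "m' = (\<lambda>x. m x - cx l p x + cx l q x)"
    using ex by (auto simp: exch_def)
  have one: "(\<Sum>x\<in>P i. witness n N P T (\<lambda>y. int (cx l a y)) i x) = (if i = l then 1 else 0)" if "a \<in> P l" for a
  proof -
    have "(\<Sum>x\<in>P i. witness n N P T (\<lambda>y. int (cx l a y)) i x) = (\<Sum>x\<in>P i. if i = l \<and> x = a then 1 else 0)"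
      using witness_cx[OF l that i] by (intro sum.cong) auto
    then show ?thesis using that finite_P[OF i] by auto
  qed
  have "int (m' x) = int (m x) - int (cx l p x) + int (cx l q x)" for x
    using pq(3)[of x] by (simp add: pq(4) of_nat_diff)
  note w = witness_exchange[where m' = "\<lambda>x. int (m' x)", OF this]
  show ?thesis
    unfolding witness_sum_def w sum.distrib sum_subtractf one[OF pq(1)] one[OF pq(2)] by simp
qed

lemma steps_witness_sum:
  assumes "(step l)\<^sup>*\<^sup>* m m'" "l \<le> n" "i \<in> {1..n}"
  shows "witness_sum n N P T m' i = witness_sum n N P T m i"
  using assms(1)
proof induction
  case (step m m')
  then show ?case using exch_witness_sum[of _ _ _ m m' i] assms(2,3) by (fastforce simp: step_def)
qed simp

text \<open>The inequality of the n-condition at \<open>j\<close>, stated without the case split of \<open>phi\<close>.\<close>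

definition cond :: "nat \<Rightarrow> ('p \<Rightarrow> nat) \<Rightarrow> bool" where
  "cond j m \<longleftrightarrow> max_pot j \<le> (\<Sum>x\<in>P (j - 1). m x) \<or>
     (\<exists>p\<in>P j. m p > 0 \<and> pot N P T j p \<le> (\<Sum>x\<in>P (j - 1). m x))"

text \<open>If level \<open>j\<close> is empty, the second disjunct of \<open>cond\<close> is void.
  Otherwise it follows from the first, as no potential exceeds the maximum.\<close>

lemma cond_iff_phi:
  assumes j: "j \<in> {2..n}"
  shows "cond j m \<longleftrightarrow> (\<Sum>x\<in>P (j - 1). m x) \<ge> phi N P T j m"
proof -
  have j1: "j \<in> {1..n}" using j by simp
  note fin = finite_P[OF j1]
  show ?thesis
  proof (cases "(\<Sum>p\<in>P j. m p) = 0")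
    case True
    then have "\<forall>p\<in>P j. m p = 0" using fin by simp
    then show ?thesis using True by (auto simp: cond_def phi_def max_pot_def)
  next
    case False
    then obtain p where "p \<in> P j" "m p > 0" by (metis gr0I sum.neutral)
    then have "{p \<in> P j. m p > 0} \<noteq> {}" by blast
    then have "phi N P T j m \<le> s \<longleftrightarrow> (\<exists>p\<in>P j. m p > 0 \<and> pot N P T j p \<le> s)" for s
      using False fin by (auto simp: phi_def Min_le_iff)
    then show ?thesis
      using \<open>p \<in> P j\<close> \<open>m p > 0\<close> pot_le_max[OF j1] unfolding cond_def by (meson le_trans)
  qed
qed

lemma n_condition_iff:
  "n_condition n N P T m \<longleftrightarrow> (\<Sum>p\<in>P n. m p) > 0 \<and> (\<forall>j\<in>{2..n}. cond j m)"
  by (simp add: n_condition_def cond_iff_phi)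

lemma cond_if_le:
  assumes j: "j \<in> {2..n}" and p: "p \<in> P j" and le: "\<And>x. cx j p x \<le> m x"
  shows "cond j m"
proof -
  have "pot N P T j p \<le> (\<Sum>x\<in>P (j - 1). m x)"
    unfolding pot_eq[OF j p] by (intro sum_mono le)
  moreover have "m p > 0" using le[of p] cx_level[of j p p] p j by simp
  ultimately show ?thesis using p by (auto simp: cond_def)
qed

text \<open>For \<open>i = j\<close> the marking \<open>m\<close> contains a complex of level
  \<open>j\<close>, which suffices. Otherwise the count at level \<open>j - 1\<close> is unchanged,
  and level \<open>j\<close> changes at most in places of maximal potential, for which the second
  disjunct of \<open>cond\<close> implies the first. The converse comes from
  \<open>exch_sym\<close>.\<close>

lemma exch_cond:
  assumes i: "i \<in> {1..n}" and ex: "exch i p q m m'" and j: "j \<in> {2..n}" and c: "cond j m'"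
  shows "cond j m"
proof (cases "i = j")
  case True
  then show ?thesis using cond_if_le[OF j, of p m] ex by (auto simp: exch_def)
next
  case ij: False
  have sum: "(\<Sum>x\<in>P (j - 1). m' x) = (\<Sum>x\<in>P (j - 1). m x)"
  proof (cases "i = j - 1")
    case True
    then show ?thesis using exch_sum_level[OF i ex] by simp
  next
    case False
    moreover have "j - 1 \<in> {1..n}" "Suc (j - 1) \<noteq> i" using j ij by auto
    ultimately show ?thesis using exch_other_level[OF i ex] by (intro sum.cong) auto
  qed
  have same: "m' x = m x" if "x \<in> P j" "pot N P T j x \<noteq> max_pot j" for x
  proof (cases "i = Suc j")
    case True
    then have "cx i p x = 0" "cx i q x = 0"
      using cx_below_max_pot[of i _ x] that i j ex by (auto simp: exch_def)
    then show ?thesis using ex by (simp add: exch_def)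
  next
    case False
    then show ?thesis using exch_other_level[OF i ex, of j x] that(1) j ij by simp
  qed
  then show ?thesis
    using c unfolding cond_def sum by (metis le_trans)
qed

lemma steps_cond:
  assumes "(step l)\<^sup>*\<^sup>* m m'" "l \<le> n" "j \<in> {2..n}"
  shows "cond j m' \<longleftrightarrow> cond j m"
  using assms(1)
proof induction
  case (step m m')
  then obtain i p q where "i \<in> {1..l}" "exch i p q m m'" by (auto simp: step_def)
  then have "cond j m' \<longleftrightarrow> cond j m"
    using exch_cond[of i _ _ _ _ j] exch_sym assms(2,3) by (metis atLeastAtMost_iff le_trans)
  with step.IH show ?case by simp
qed simp

lemma steps_sum_top:
  assumes "(step n)\<^sup>*\<^sup>* m m'"
  shows "(\<Sum>x\<in>P n. m' x) = (\<Sum>x\<in>P n. m x)"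
  using assms
proof induction
  case (step m m')
  then obtain i p q where i: "i \<in> {1..n}" "exch i p q m m'" by (auto simp: step_def)
  have "(\<Sum>x\<in>P n. m' x) = (\<Sum>x\<in>P n. m x)"
  proof (cases "i = n")
    case True
    then show ?thesis using exch_sum_level[OF i] by simp
  next
    case False
    then show ?thesis using exch_other_level[OF i, of n] i by (intro sum.cong) auto
  qed
  with step.IH show ?case by simp
qed simp

text \<open>For each \<open>j\<close> some reachable marking enables a transition of
  \<open>T j\<close> and so contains a complex of level \<open>j\<close>. There the inequality is
  evident, and invariance carries it back to \<open>m\<close>; at the top level the same is done
  with the token count.\<close>

lemma live_n_condition:
  assumes live: "live N m"
  shows "n_condition n N P T m"
proof -
  have en: "\<exists>m'. (step n)\<^sup>*\<^sup>* m m' \<and> enabled N m' t" if "t \<in> transitions N" for t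
    using live that unfolding live_def reachability_set_def fires_eq_steps by blast
  have "\<exists>p\<in>P j. \<exists>m'. (step n)\<^sup>*\<^sup>* m m' \<and> (\<forall>x. cx j p x \<le> m' x)" if j: "j \<in> {2..n}" for j
  proof -
    have j1: "j \<in> {1..n}" using j by simp
    obtain t where t: "t \<in> T j" using T_nonempty[OF j] by blast
    then have "t \<in> transitions N" using j1 by (auto simp: transitions_eq)
    then obtain m' where m': "(step n)\<^sup>*\<^sup>* m m'" "enabled N m' t" using en by blast
    obtain p where p: "p \<in> P j" "inp N t p > 0"
      using machine_inp_out(1)[OF j1 t] by (metis zero_less_one)
    then have "\<forall>x. cx j p x \<le> m' x"
      using m'(2) inp_eq_cx[OF j1 t p] by (simp add: enabled_def)
    then show ?thesis using m'(1) p(1) by blast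
  qed
  note A = this
  have "cond j m" if j: "j \<in> {2..n}" for j
    using A[OF j] cond_if_le[OF j] steps_cond[OF _ _ j] by blast
  moreover have "(\<Sum>p\<in>P n. m p) > 0"
  proof -
    have n: "n \<in> {1..n}" using n_ge_2 by simp
    obtain p m' where p: "p \<in> P n" "(step n)\<^sup>*\<^sup>* m m'" "\<And>x. cx n p x \<le> m' x"
      using A[of n] n_ge_2 by auto
    then have "m' p > 0" using cx_level[OF n p(1,1)] p(3)[of p] by simp
    then have "(\<Sum>x\<in>P n. m' x) > 0" using p(1) finite_P[OF n] by (metis gr0I sum_eq_0_iff less_irrefl)
    then show ?thesis using steps_sum_top[OF p(2)] by simp
  qed
  ultimately show ?thesis by (simp add: n_condition_iff)
qed

section \<open>Gathering the tokens of a level at places of maximal potential\<close>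

text \<open>Outer induction on the level, inner induction on the surplus of \<open>m\<close> over
  \<open>d\<close>, a sum of truncated differences. Each round moves one token from a surplus place
  \<open>p\<close> to a deficient place \<open>q\<close>, after gathering at level
  \<open>i - 1\<close> the tokens that the complex of \<open>p\<close> requires.\<close>

lemma gather:
  assumes "i \<in> {1..n}" "\<And>j. j \<in> {2..i} \<Longrightarrow> cond j m"
    and "(\<Sum>x\<in>P i. d x) = (\<Sum>x\<in>P i. m x)"
    and "\<And>x. \<lbrakk>x \<in> P i; d x > 0\<rbrakk> \<Longrightarrow> pot N P T i x = max_pot i"
  shows "\<exists>m'. (step i)\<^sup>*\<^sup>* m m' \<and> (\<forall>x\<in>P i. m' x = d x)"
  using assms
proof (induction i arbitrary: m d rule: less_induct)
  case (less i)
  note outer_IH = less.IH and i = less.prems(1) and dmax = less.prems(4)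
  note fin = finite_P[OF i]
  from less.prems(2,3) show ?case
  proof (induction "\<Sum>x\<in>P i. m x - d x" arbitrary: m rule: less_induct)
    case (less m)
    note inner_IH = less.hyps and conds = less.prems(1) and sums = less.prems(2)
    show ?case
    proof (cases "\<exists>y\<in>P i. m y > d y")
      case False
      then have "m x = d x" if "x \<in> P i" for x
        using sum_mono_inv[OF sums[symmetric] _ that fin] by (simp add: not_less)
      then show ?thesis by blast
    next
      case True
      then obtain y where y: "y \<in> P i" "m y > d y" by blast
      \<comment> \<open>A surplus place whose potential level \<open>i - 1\<close> can pay for. If
        that level cannot pay the maximum, \<open>cond i m\<close> offers a marked place of smaller
        potential, which is surplus because \<open>d\<close> vanishes there.\<close>
      obtain p where p: "p \<in> P i" "m p > d p"
        and pot_p: "i \<ge> 2 \<Longrightarrow> pot N P T i p \<le> (\<Sum>x\<in>P (i - 1). m x)"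
      proof (cases "i \<ge> 2 \<and> \<not> max_pot i \<le> (\<Sum>x\<in>P (i - 1). m x)")
        case True
        then have "cond i m" using conds by simp
        then obtain x where x: "x \<in> P i" "m x > 0" "pot N P T i x \<le> (\<Sum>x\<in>P (i - 1). m x)"
          using True by (auto simp: cond_def)
        then have "d x = 0" using True dmax[of x] by fastforce
        then show ?thesis using that x by simp
      next
        case False
        then show ?thesis using that y pot_le_max[OF i y(1)] by fastforce
      qed
      obtain q where q: "q \<in> P i" "m q < d q"
      proof -
        have False if "\<forall>x\<in>P i. d x \<le> m x"
          using sum_strict_mono_ex1[OF fin that] p sums by auto
        then show thesis using that by (meson not_less)
      qed
      \<comment> \<open>Levels below \<open>i\<close> are prepared so that the complex of
        \<open>p\<close> is present; at level 1 it is a single token.\<close>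
      have "\<exists>m1. (step (i - 1))\<^sup>*\<^sup>* m m1 \<and> (\<forall>x\<in>P i. m1 x = m x) \<and> (\<forall>x. cx i p x \<le> m1 x)"
      proof (cases "i = 1")
        case True
        then have "cx i p x \<le> m x" for x using p by (auto simp: cx_def)
        then show ?thesis by blast
      next
        case False
        then have i2: "i \<in> {2..n}" and i1: "i - 1 \<in> {1..n}" "i - 1 < i" using i by auto
        obtain h where h: "h \<in> P (i - 1)" "pot N P T (i - 1) h = max_pot (i - 1)"
          using max_pot_attained[OF i1(1)] .
        define s where "s = (\<Sum>x\<in>P (i - 1). m x)"
        \<comment> \<open>The target at level \<open>i - 1\<close>: what the complex of
          \<open>p\<close> requires, with all spare tokens at \<open>h\<close>. It is admissible for
          the outer hypothesis by \<open>cx_below_max_pot\<close>.\<close>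
        define d' where "d' x = cx i p x + (if x = h then s - pot N P T i p else 0)" for x
        have "(\<Sum>x\<in>P (i - 1). d' x) = s"
          using pot_p i2 h finite_P[OF i1(1)] pot_eq[OF i2 p(1)] by (simp add: d'_def sum.distrib s_def)
        moreover have "pot N P T (i - 1) x = max_pot (i - 1)" if "x \<in> P (i - 1)" "d' x > 0" for x
          using that cx_below_max_pot[OF i2 p(1)] h(2) by (auto simp: d'_def split: if_splits)
        moreover have "cond j m" if "j \<in> {2..i - 1}" for j
          using conds[of j] that by auto
        ultimately obtain m1 where m1: "(step (i - 1))\<^sup>*\<^sup>* m m1" "\<And>x. x \<in> P (i - 1) \<Longrightarrow> m1 x = d' x"
          using outer_IH[OF i1(2,1), of m d'] unfolding s_def by blast
        have above: "m1 x = m x" if "x \<in> P i" for x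
          using steps_above[OF m1(1) i1(2) _ that] i by simp
        have "cx i p x \<le> m1 x" for x
        proof -
          consider "x \<in> P i" | "x \<in> P (i - 1)" | "x \<notin> P i" "x \<notin> P (i - 1)" by blast
          then show ?thesis
          proof cases
            case 1
            then show ?thesis using above p by (simp add: cx_level[OF i])
          next
            case 2
            then show ?thesis using m1(2) by (simp add: d'_def)
          next
            case 3
            then show ?thesis using cx_other[OF i p(1)] by simp
          qed
        qed
        then show ?thesis using m1(1) above by blast
      qed
      then obtain m1 where m1: "(step (i - 1))\<^sup>*\<^sup>* m m1" "\<And>x. x \<in> P i \<Longrightarrow> m1 x = m x"
        "\<And>x. cx i p x \<le> m1 x" by blast
      define m2 where "m2 = (\<lambda>x. m1 x - cx i p x + cx i q x)"
      have ex: "exch i p q m1 m2" using p q m1(3) by (simp add: exch_def m2_def)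
      then have "step i m1 m2" using i unfolding step_def by (intro bexI[of _ i]) auto
      then have m2: "(step i)\<^sup>*\<^sup>* m m2"
        using steps_mono[OF m1(1), of i] by (simp add: rtranclp.rtrancl_into_rtrancl)
      have lev: "m2 x = m x - (if x = p then 1 else 0) + (if x = q then 1 else 0)" if "x \<in> P i" for x
        using that p q by (simp add: m2_def m1 cx_level[OF i])
      \<comment> \<open>The surplus falls by one at \<open>p\<close>, and the extra token at
        \<open>q\<close> creates none since \<open>m q < d q\<close>.\<close>
      have "(\<Sum>x\<in>P i. m2 x - d x) < (\<Sum>x\<in>P i. m x - d x)"
        using p q by (intro sum_strict_mono_ex1[OF fin]) (auto simp: lev intro!: bexI[of _ p])
      moreover have "cond j m2" if "j \<in> {2..i}" for j
        using steps_cond[OF m2, of j] conds[OF that] that i by simp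
      moreover have "(\<Sum>x\<in>P i. d x) = (\<Sum>x\<in>P i. m2 x)"
        using exch_sum_level[OF i ex] sums m1(2) by simp
      ultimately obtain m' where "(step i)\<^sup>*\<^sup>* m2 m'" "\<forall>x\<in>P i. m' x = d x"
        using inner_IH[of m2] by blast
      then show ?thesis using m2 by (meson rtranclp_trans)
    qed
  qed
qed

text \<open>Both markings are moved until they meet; the path of the second is then reversed by
  \<open>steps_sym\<close>.\<close>

lemma steps_between:
  assumes M: "m \<in> markings N" "m' \<in> markings N"
    and conds: "\<And>j. j \<in> {2..n} \<Longrightarrow> cond j m" "\<And>j. j \<in> {2..n} \<Longrightarrow> cond j m'"
    and wit: "\<And>i. i \<in> {1..n} \<Longrightarrow> witness_sum n N P T m i = witness_sum n N P T m' i"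
  shows "(step n)\<^sup>*\<^sup>* m m'"
proof -
  have "\<exists>a b. (step n)\<^sup>*\<^sup>* m a \<and> (step n)\<^sup>*\<^sup>* m' b \<and> (\<forall>k x. l < k \<and> k \<le> n \<and> x \<in> P k \<longrightarrow> a x = b x)"
    if "l \<le> n" for l
    using that
  proof (induction l rule: inc_induct)
    case base
    then show ?case by (intro exI[of _ m] exI[of _ m']) auto
  next
    case (step l)
    define i where "i = Suc l"
    have i: "i \<in> {1..n}" using step by (simp add: i_def)
    obtain a b where ab: "(step n)\<^sup>*\<^sup>* m a" "(step n)\<^sup>*\<^sup>* m' b"
      and eq: "\<And>k x. \<lbrakk>i < k; k \<le> n; x \<in> P k\<rbrakk> \<Longrightarrow> a x = b x"
      using step.IH unfolding i_def by blast
    \<comment> \<open>Agreement above \<open>i\<close> makes the correction terms equal, so the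
      witness sums compare the plain token counts of level \<open>i\<close>.\<close>
    have "witness n N P T (\<lambda>y. int (a y)) i x - int (a x) = witness n N P T (\<lambda>y. int (b y)) i x - int (b x)" for x
      using eq by (intro witness_diff_cong) simp
    then have "witness_sum n N P T a i - (\<Sum>x\<in>P i. int (a x)) = witness_sum n N P T b i - (\<Sum>x\<in>P i. int (b x))"
      unfolding witness_sum_def sum_subtractf[symmetric] by simp
    moreover have "witness_sum n N P T a i = witness_sum n N P T b i"
      using steps_witness_sum[OF ab(1) order.refl i] steps_witness_sum[OF ab(2) order.refl i] wit[OF i] by simp
    ultimately have tot: "(\<Sum>x\<in>P i. a x) = (\<Sum>x\<in>P i. b x)"
      by (simp flip: of_nat_sum)
    obtain h where h: "h \<in> P i" "pot N P T i h = max_pot i"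
      using max_pot_attained[OF i] .
    \<comment> \<open>One common target for both markings: all tokens of level \<open>i\<close> at
      one place of maximal potential.\<close>
    define d where "d x = (if x = h then \<Sum>x\<in>P i. a x else 0)" for x
    have d: "(\<Sum>x\<in>P i. d x) = (\<Sum>x\<in>P i. a x)" "\<And>x. d x > 0 \<Longrightarrow> pot N P T i x = max_pot i"
      using h finite_P[OF i] by (auto simp: d_def split: if_splits)
    have ca: "cond j a" and cb: "cond j b" if "j \<in> {2..i}" for j
      using steps_cond[OF ab(1), of j] steps_cond[OF ab(2), of j] conds[of j] that i by auto
    obtain a' where a': "(step i)\<^sup>*\<^sup>* a a'" "\<And>x. x \<in> P i \<Longrightarrow> a' x = d x"
      using gather[OF i ca d] by blast
    obtain b' where b': "(step i)\<^sup>*\<^sup>* b b'" "\<And>x. x \<in> P i \<Longrightarrow> b' x = d x"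
      using gather[OF i cb d(1)[unfolded tot] d(2)] by blast
    have "a' x = b' x" if "l < k" "k \<le> n" "x \<in> P k" for k x
    proof (cases "k = i")
      case True
      then show ?thesis using a' b' that by simp
    next
      case False
      then have "i < k" using that by (simp add: i_def)
      then show ?thesis
        using steps_above[OF a'(1) _ that(2,3)] steps_above[OF b'(1) _ that(2,3)] eq that by simp
    qed
    moreover have "(step n)\<^sup>*\<^sup>* m a'" "(step n)\<^sup>*\<^sup>* m' b'"
      using ab steps_mono[OF a'(1), of n] steps_mono[OF b'(1), of n] i by (auto intro: rtranclp_trans)
    ultimately show ?case by blast
  qed
  \<comment> \<open>At \<open>l = 0\<close> all levels agree, and outside the places both markings
    vanish.\<close>
  from this[of 0] obtain a b where ab: "(step n)\<^sup>*\<^sup>* m a" "(step n)\<^sup>*\<^sup>* m' b"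
    and eq: "\<And>k x. \<lbrakk>0 < k; k \<le> n; x \<in> P k\<rbrakk> \<Longrightarrow> a x = b x" by blast
  have "a x = b x" for x
  proof (cases "x \<in> places N")
    case True
    then obtain k where "k \<in> {1..n}" "x \<in> P k" unfolding places_eq by blast
    then show ?thesis using eq[of k x] by simp
  next
    case False
    then show ?thesis
      using M steps_outside[OF ab(1) order.refl False] steps_outside[OF ab(2) order.refl False]
      by (simp add: markings_def)
  qed
  then have "a = b" by blast
  then show ?thesis using ab steps_sym by (metis rtranclp_trans)
qed

end

theorem theorem3:
  fixes n :: nat
    and N :: "('p, 't) petri_net"
    and P :: "nat \<Rightarrow> 'p set"
    and T :: "nat \<Rightarrow> 't set"
    and m0 :: "'p \<Rightarrow> nat"
  assumes "pi3_net n N P T"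
    and "m0 \<in> markings N"
    and "live N m0"
  shows "reachability_set N m0 = S_set n N P T m0"
proof -
  interpret pi3 n N P T using assms(1) by unfold_locales
  have cond0: "n_condition n N P T m0" using assms(3) by (rule live_n_condition)
  show ?thesis
  proof (intro set_eqI iffI)
    fix m assume "m \<in> reachability_set N m0"
    then have m: "(step n)\<^sup>*\<^sup>* m0 m" by (simp add: reachability_set_def fires_eq_steps)
    have "m \<in> markings N"
      using steps_outside[OF m] assms(2) by (simp add: markings_def)
    moreover have "n_condition n N P T m"
      using cond0 steps_sum_top[OF m] steps_cond[OF m] by (simp add: n_condition_iff)
    ultimately show "m \<in> S_set n N P T m0"
      using steps_witness_sum[OF m] by (simp add: S_set_def)
  next
    fix m assume "m \<in> S_set n N P T m0"
    then show "m \<in> reachability_set N m0"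
      using cond0 assms(2) steps_between[of m0 m]
      by (auto simp: S_set_def n_condition_iff reachability_set_def fires_eq_steps)
  qed
qed

end
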